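(* For any $\delta>0$ there exists $\eta_1>0$ such that, for all $\eta\in(0,\eta_1)$, the maximal spectral abscissa $\sigma_\eta=\sup\{\operatorname{Re}(s): s\in\mathcal{S}_\eta\}$ satisfies $$\sigma_\eta\leqslant -\ln(2)+\delta .$$
   Context: Let $\eta>0$ (viscosity). For $s\in\mathbb{C}$ set $$\lambda_1(s)=\frac{1+\sqrt{1+4\eta s}}{2\eta},\qquad \lambda_2(s)=\frac{1-\sqrt{1+4\eta s}}{2\eta},$$ where $\sqrt{\cdot}$ is the principal value of the square root, and $$f_\eta(s)=\frac{\lambda_1(s)-\lambda_2(s)}{\lambda_1(s)e^{-\lambda_2(s)}-\lambda_2(s)e^{-\lambda_1(s)}} .$$ (The expression for $f_\eta$ is symmetric under exchange of $\lambda_1$ and $\lambda_2$, so its value does not depend on the choice of the square root, including when $1+4\eta s$ is a negative real number.) The spectrum $\mathcal{S}_\eta$ is the set of roots $s\in\mathbb{C}$ of the characteristic equation $$f_\eta^2(s)-f_\eta(s)e^{-s}-1=0,$$ where the point $s=-1/(4\eta)$, at which $\lambda_1=\lambda_2$ and both numerator and denominator of $f_\eta$ vanish, is by convention counted as an element of $\mathcal{S}_\eta$. Origin: this is the characteristic equation of the closed loop system $\partial_t y_i+\partial_x y_i-\eta\,\partial_{xx}^2y_i=0$ ($i=1,2$, $x\in(0,1)$), $y_1(t,0)=y_2(t,1)+U(t)$, $y_2(t,0)=y_1(t,1)$, $\partial_xy_1(t,1)=\partial_xy_2(t,1)=0$, with the output feedback $U(t)=-y_1(t-1,1)$; here $f_\eta$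 is the transfer function from $y_i(\cdot,0)$ to $y_i(\cdot,1)$. *)

theory Defs
  imports Complex_Main "HOL-Library.Extended_Real"
begin

definition lambda1 :: "real \<Rightarrow> complex \<Rightarrow> complex" where
  "lambda1 \<eta> s = (1 + csqrt (1 + 4 * of_real \<eta> * s)) / (2 * of_real \<eta>)"

definition lambda2 :: "real \<Rightarrow> complex \<Rightarrow> complex" where
  "lambda2 \<eta> s = (1 - csqrt (1 + 4 * of_real \<eta> * s)) / (2 * of_real \<eta>)"

definition transfer_denom :: "real \<Rightarrow> complex \<Rightarrow> complex" where
  "transfer_denom \<eta> s =
     lambda1 \<eta> s * exp (- lambda2 \<eta> s) - lambda2 \<eta> s * exp (- lambda1 \<eta> s)"

definition transfer :: "real \<Rightarrow> complex \<Rightarrow> complex" where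
  "transfer \<eta> s = (lambda1 \<eta> s - lambda2 \<eta> s) / transfer_denom \<eta> s"

text \<open>
  Points where the denominator vanishes are excluded from the roots explicitly, rather than
  through the convention \<open>x / 0 = 0\<close>. The point \<open>-1/(4\<eta>)\<close>, at which the
  quotient has the form 0/0, belongs to the spectrum by convention.
\<close>

definition spectrum_eta :: "real \<Rightarrow> complex set" where
  "spectrum_eta \<eta> =
     {s. transfer_denom \<eta> s \<noteq> 0 \<and>
         (transfer \<eta> s)\<^sup>2 - transfer \<eta> s * exp (- s) - 1 = 0}
     \<union> {- 1 / (4 * of_real \<eta>)}"

text \<open>
  The supremum is taken in the extended reals, so that an upper bound on it
  includes the boundedness of the real parts of the spectrum.
\<close>

definition spectral_abscissa :: "real \<Rightarrow> ereal" where
  "spectral_abscissa \<eta> = (SUP s\<in>spectrum_eta \<eta>. ereal (Re s))"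

end

theory Submission
  imports Defs
begin

text \<open>
  Put \<open>q = csqrt (1 + 4\<eta>s)\<close>, so that \<open>s = (q\<^sup>2 - 1) / (4\<eta>)\<close>. A root satisfies
  \<open>f (f - z) = 1\<close> with \<open>f = transfer \<eta> s\<close> and \<open>z = exp (-s)\<close>, so it is enough that
  \<open>|f| |f - z| < 1\<close> whenever \<open>Re s \<ge> -ln 2 + \<delta>\<close> and \<open>\<eta>\<close> is small.

  Factor \<open>f = exp ((1 - q) / (2\<eta>)) g\<close>, where \<open>g\<close> tends to 1 as \<open>q \<rightarrow> 1\<close>,
  uniformly in \<open>\<eta>\<close> (\<open>norm_gain_minus_1_le\<close>). Write \<open>q = 1 + 2\<eta>t + ib\<close>. Then
  \<open>Re s = t + \<eta>t\<^sup>2 - b\<^sup>2/(4\<eta>)\<close>, and up to the common phase \<open>exp (-ib/(2\<eta>))\<close> the numbers \<open>f\<close>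
  and \<open>z\<close> are \<open>X g\<close> and \<open>Z exp (-ibt)\<close>, with \<open>X = exp (-t)\<close> and \<open>Z = exp (- Re s)\<close>. If \<open>g\<close>
  and \<open>exp (-ibt)\<close> were exactly 1, the quantity to bound would be \<open>X |X - Z|\<close>. Viscosity
  damps, that is, \<open>X \<le> Z\<close> up to the factor \<open>exp (\<eta>t\<^sup>2)\<close>, and so
  \<open>X |X - Z| \<le> Z\<^sup>2/4 \<le> exp (-2\<delta>) < 1\<close> up to a small error (\<open>mult_abs_diff_le\<close>). The
  constant \<open>-ln 2\<close> is the value of \<open>Re s\<close> at which \<open>Z\<^sup>2/4 = 1\<close>.

  The approximation is uniform, although \<open>s\<close> ranges over an unbounded set. The half plane gives
  \<open>t \<ge> -2\<close>. If \<open>t \<ge> 4\<close>, then \<open>X\<close> is so small that the crude bound \<open>|g| \<le> 3\<close>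
  (\<open>norm_gain_le_3\<close>) suffices. If \<open>-2 \<le> t < 4\<close>, then the formula for \<open>Re s\<close> bounds
  \<open>b\<^sup>2/\<eta>\<close>; hence \<open>q - 1\<close> and \<open>bt\<close>, and with them all the errors, are of order
  \<open>sqrt \<eta>\<close>, however large the imaginary part \<open>b / (2\<eta>) + bt\<close> of \<open>s\<close> is.

  The exceptional point \<open>-1/(4\<eta>)\<close> moves off to the left as \<open>\<eta> \<rightarrow> 0\<close>.
\<close>

text \<open>
  The factor of the transfer function that remains after splitting off \<open>exp (\<lambda>\<^sub>2)\<close>; its second
  exponential is \<open>exp (\<lambda>\<^sub>2 - \<lambda>\<^sub>1)\<close>, which is negligible when \<open>\<eta>\<close> is small and
  \<open>Re q\<close> is near 1.
\<close>

definition gain :: "real \<Rightarrow> complex \<Rightarrow> complex" where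
  "gain \<eta> q = 2 * q / (1 + q - (1 - q) * exp (- q / of_real \<eta>))"

lemma transfer_eq_exp_times_gain:
  fixes \<eta> :: real and s :: complex
  defines "q \<equiv> csqrt (1 + 4 * of_real \<eta> * s)"
  assumes "\<eta> \<noteq> 0"
  shows "transfer \<eta> s = exp ((1 - q) / (2 * of_real \<eta>)) * gain \<eta> q"
proof -
  define h :: complex where "h = of_real \<eta>"
  define E where "E = exp ((1 - q) / (2 * h))"
  have h: "h \<noteq> 0" using assms by (simp add: h_def)
  have E: "E \<noteq> 0" by (simp add: E_def)
  have l1: "lambda1 \<eta> s = (1 + q) / (2 * h)" and l2: "lambda2 \<eta> s = (1 - q) / (2 * h)"
    by (simp_all add: lambda1_def lambda2_def q_def h_def)
  have e2: "exp (- lambda2 \<eta> s) = 1 / E"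
    by (simp add: l2 E_def exp_minus field_simps)
  have "- lambda1 \<eta> s = - lambda2 \<eta> s + (- q / h)"
    using h by (simp add: l1 l2 field_simps)
  then have e1: "exp (- lambda1 \<eta> s) = 1 / E * exp (- q / h)"
    by (simp only: exp_add e2)
  have "transfer_denom \<eta> s = (1 + q - (1 - q) * exp (- q / h)) / (2 * h * E)"
    unfolding transfer_denom_def e1 e2 unfolding l1 l2 using h E by (simp add: divide_simps)
  moreover have "lambda1 \<eta> s - lambda2 \<eta> s = 2 * q / (2 * h)"
    using h by (simp add: l1 l2 field_simps)
  ultimately show ?thesis
    using h E by (simp add: transfer_def gain_def flip: h_def E_def)
qed

text \<open>
  In the right half plane \<open>1 + q\<close> dominates both \<open>q\<close> and \<open>1 - q\<close>, and the exponential is at most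
  1/3 in modulus, so the denominator keeps at least two thirds of \<open>|1 + q|\<close>. This covers large \<open>|q|\<close>, where \<open>gain\<close> is near 2 and not near 1.
\<close>

lemma norm_gain_le_3:
  assumes "0 < \<eta>" "\<eta> \<le> 1/4" "Re q \<ge> 1/2"
  shows "norm (gain \<eta> q) \<le> 3"
proof -
  define e where "e = norm (exp (- q / of_real \<eta>))"
  have "e = exp (- (Re q / \<eta>))" by (simp add: e_def)
  also have "\<dots> \<le> exp (- 2)" using assms by (simp add: field_simps)
  also have "\<dots> \<le> 1/3"
    using exp_ge_add_one_self[of "2::real"] by (simp add: exp_minus field_simps)
  finally have e: "e \<le> 1/3" .
  have sq: "(norm (1 + q))\<^sup>2 = (norm (1 - q))\<^sup>2 + 4 * Re q"
           "(norm (1 + q))\<^sup>2 = (norm q)\<^sup>2 + 1 + 2 * Re q"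
    unfolding cmod_power2 by (simp_all add: power2_eq_square algebra_simps)
  have minus_le: "norm (1 - q) \<le> norm (1 + q)" and q_le: "norm q \<le> norm (1 + q)"
    using sq assms by (auto intro: power2_le_imp_le)
  have pos: "norm (1 + q) > 0"
  proof -
    have "1 + q \<noteq> 0" using assms by (auto simp: complex_eq_iff)
    then show ?thesis by simp
  qed
  have "norm (1 - q) * e \<le> norm (1 + q) * (1/3)"
    using minus_le e by (intro mult_mono) (auto simp: e_def)
  then have "norm (1 + q - (1 - q) * exp (- q / of_real \<eta>)) \<ge> 2/3 * norm (1 + q)"
    using norm_triangle_ineq2[of "1 + q" "(1 - q) * exp (- q / of_real \<eta>)"]
    by (simp add: norm_mult e_def del: norm_exp_eq_Re)
  moreover from this pos have "norm (1 + q - (1 - q) * exp (- q / of_real \<eta>)) > 0" by linarith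
  ultimately show ?thesis using q_le unfolding gain_def norm_divide norm_mult
    by (simp add: divide_le_eq)
qed

text \<open>
  With the notation of the proof, \<open>gain \<eta> q - 1 = (q - 1) (1 - E) / D\<close>, where \<open>|E| \<le> 1\<close> and
  \<open>|D| \<ge> 1\<close>: the error does not depend on \<open>\<eta>\<close>.
\<close>

lemma norm_gain_minus_1_le:
  assumes "0 < \<eta>" "Re q \<ge> 0" "norm (q - 1) \<le> 1/2"
  shows "norm (gain \<eta> q - 1) \<le> 2 * norm (q - 1)"
proof -
  define E where "E = exp (- q / of_real \<eta>)"
  have E: "norm E \<le> 1" using assms by (simp add: E_def)
  define D where "D = 1 + q - (1 - q) * E"
  have gain_eq: "gain \<eta> q = 2 * q / D" by (simp add: gain_def D_def E_def)
  have D_eq: "D = 2 + (q - 1) * (1 + E)" by (simp add: D_def algebra_simps)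
  have "norm (1 + E) \<le> 2" "norm (1 - E) \<le> 2"
    using norm_triangle_ineq[of 1 E] norm_triangle_ineq4[of 1 E] E by auto
  moreover have "norm ((q - 1) * (1 + E)) \<le> 1/2 * 2"
    unfolding norm_mult using assms calculation by (intro mult_mono) auto
  moreover have "norm D \<ge> 2 - norm ((q - 1) * (1 + E))"
    unfolding D_eq using norm_diff_ineq[of 2 "(q - 1) * (1 + E)"] by simp
  ultimately have D: "norm D \<ge> 1" and E1: "norm (1 - E) \<le> 2" by auto
  then have "D \<noteq> 0" by auto
  then have "gain \<eta> q - 1 = (q - 1) * (1 - E) / D"
    unfolding gain_eq by (simp add: divide_simps) (simp add: D_def algebra_simps)
  then have "norm (gain \<eta> q - 1) = norm (q - 1) * norm (1 - E) / norm D"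
    by (simp add: norm_mult norm_divide)
  also have "\<dots> \<le> norm (q - 1) * 2 / 1"
    using D E1 by (intro frac_le mult_left_mono) auto
  finally show ?thesis by simp
qed

lemma norm_cis_minus_1_le: "norm (cis x - 1) \<le> \<bar>x\<bar>"
proof -
  have "(norm (cis x - 1))\<^sup>2 = (sin x)\<^sup>2 + (cos x)\<^sup>2 + 1 - 2 * cos x"
    unfolding cmod_power2 by (simp add: power2_eq_square algebra_simps)
  also have "\<dots> = 4 * (sin (x/2))\<^sup>2"
    using cos_double_sin[of "x/2"] sin_cos_squared_add[of x] by simp
  also have "\<dots> \<le> 4 * (x/2)\<^sup>2"
    using abs_sin_x_le_abs_x[of "x/2"] abs_le_square_iff[of "sin (x/2)" "x/2"]
    by (intro mult_left_mono) auto
  finally have "(norm (cis x - 1))\<^sup>2 \<le> \<bar>x\<bar>\<^sup>2" by (simp add: power2_eq_square)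
  then show ?thesis by (rule power2_le_imp_le) simp
qed

text \<open>
  For \<open>X \<le> Z\<close> the term \<open>Z\<^sup>2/4\<close> is the maximum of \<open>X (Z - X)\<close>, attained at \<open>X = Z/2\<close>. The term with \<open>\<epsilon>\<close> covers
  the possibility that \<open>X\<close> exceeds \<open>Z\<close> slightly.
\<close>

lemma mult_abs_diff_le:
  fixes X Z M \<epsilon> :: real
  assumes "0 \<le> X" "0 \<le> \<epsilon>" "0 \<le> M" "X \<le> M" "0 \<le> Z" "X \<le> Z * (1 + \<epsilon>)"
  shows "X * \<bar>X - Z\<bar> \<le> Z\<^sup>2 / 4 + M * Z * \<epsilon>"
proof (cases "X \<le> Z")
  case True
  have "X * \<bar>X - Z\<bar> = Z\<^sup>2 / 4 - (X - Z/2)\<^sup>2"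
    using True by (simp add: power2_eq_square algebra_simps)
  moreover have "0 \<le> M * Z * \<epsilon>" using assms by simp
  ultimately show ?thesis by (smt (verit) zero_le_power2)
next
  case False
  then have "X * \<bar>X - Z\<bar> \<le> M * (Z * \<epsilon>)"
    using assms by (intro mult_mono) (auto simp: algebra_simps)
  then show ?thesis by (smt (verit) mult.assoc zero_le_power2 zero_le_divide_iff)
qed

text \<open>
  The heart of the matter. The constant 7000 is a crude bound for the accumulated first order
  errors, all of them measured in units of \<open>r = sqrt \<eta>\<close>.
\<close>

lemma norm_transfer_product_less_1:
  fixes \<eta> \<delta> :: real and s :: complex
  assumes \<eta>: "0 < \<eta>" and small: "sqrt \<eta> < (1 - exp (- 2 * \<delta>)) / 7000"
    and s: "Re s \<ge> - ln 2 + \<delta>" and \<delta>: "\<delta> > 0"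
  shows "norm (transfer \<eta> s) * norm (transfer \<eta> s - exp (- s)) < 1"
proof -
  define q where "q = csqrt (1 + 4 * of_real \<eta> * s)"
  define t where "t = (Re q - 1) / (2 * \<eta>)"
  define b where "b = Im q"
  define \<sigma> where "\<sigma> = Re s"
  define r where "r = sqrt \<eta>"
  define X where "X = exp (- t)"
  define Z where "Z = exp (- \<sigma>)"
  define g where "g = gain \<eta> q"
  have r: "0 < r" "r < 1/7000" and \<eta>_eq: "\<eta> = r * r"
    using \<eta> small exp_gt_zero[of "- 2 * \<delta>"] by (auto simp: r_def simp del: exp_gt_zero)
  have "r * r \<le> 1/7000 * (1/7000)" using r by (intro mult_mono) auto
  then have \<eta>_le: "\<eta> \<le> 1/49000000" by (simp add: \<eta>_eq)
  have Req: "Re q = 1 + 2 * \<eta> * t" using \<eta> by (simp add: t_def)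
  have Req0: "Re q \<ge> 0" using csqrt_principal[of "1 + 4 * of_real \<eta> * s"] by (auto simp: q_def)
  have "q\<^sup>2 = 1 + 4 * of_real \<eta> * s" by (simp add: q_def)
  then have s_eq: "s = (q\<^sup>2 - 1) / (4 * of_real \<eta>)" using \<eta> by simp
  have q_eq: "q = Complex (1 + 2 * \<eta> * t) b" by (simp add: complex_eq_iff Req b_def)
  have \<sigma>_eq: "\<sigma> = t + \<eta> * t\<^sup>2 - b\<^sup>2 / (4 * \<eta>)"
    and Ims: "Im s = b / (2 * \<eta>) + b * t"
    unfolding \<sigma>_def s_eq q_eq using \<eta>
    by (auto simp: complex_eq_iff Re_divide Im_divide power2_eq_square field_simps)
  have \<sigma>: "\<sigma> \<ge> - 1" using s \<delta> ln_2_less_1 by (simp add: \<sigma>_def)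
  \<comment> \<open>The branch \<open>Re q \<ge> 0\<close> excludes very negative \<open>t\<close>, for which \<open>\<eta>t\<^sup>2\<close> would outweigh \<open>t\<close>.\<close>
  have "t \<ge> - 2"
  proof (rule ccontr)
    assume "\<not> t \<ge> - 2"
    moreover have "1 + \<eta> * t \<ge> 1/2" using Req0 Req by simp
    ultimately have "t * (1 + \<eta> * t) \<le> t * (1/2)"
      by (intro mult_left_mono_neg) auto
    moreover have "b\<^sup>2 / (4 * \<eta>) \<ge> 0" using \<eta> by simp
    ultimately show False using \<sigma>_eq \<sigma> \<open>\<not> t \<ge> - 2\<close>
      by (simp add: power2_eq_square algebra_simps)
  qed
  \<comment> \<open>The phase common to \<open>f\<close> and \<open>exp (-s)\<close>. It oscillates as \<open>\<eta> \<rightarrow> 0\<close>, but norms do not see it.\<close>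
  define C where "C = cis (- b / (2 * \<eta>))"
  have f_eq: "transfer \<eta> s = C * (of_real X * g)"
  proof -
    have "(1 - q) / (2 * of_real \<eta>) = Complex (- t) (- b / (2 * \<eta>))"
      unfolding q_eq using \<eta> by (simp add: complex_eq_iff Re_divide Im_divide power2_eq_square)
    then have "exp ((1 - q) / (2 * of_real \<eta>)) = of_real X * C"
      by (simp add: exp_eq_polar X_def C_def)
    then show ?thesis
      using transfer_eq_exp_times_gain[of \<eta> s] \<eta> by (simp add: g_def q_def)
  qed
  have z_eq: "exp (- s) = C * (of_real Z * cis (- b * t))"
    by (simp add: exp_eq_polar Z_def \<sigma>_def C_def Ims cis_mult)
  have normf: "norm (transfer \<eta> s) = X * norm g"
    by (simp add: f_eq norm_mult C_def X_def)
  have "transfer \<eta> s - exp (- s) = C * (of_real X * g - of_real Z * cis (- b * t))"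
    by (simp add: f_eq z_eq algebra_simps)
  then have normfz: "norm (transfer \<eta> s - exp (- s)) = norm (of_real X * g - of_real Z * cis (- b * t))"
    by (simp add: norm_mult C_def)
  have XZ0: "X > 0" "Z > 0" by (simp_all add: X_def Z_def)
  have "Z \<le> exp (ln 2 - \<delta>)" using s by (simp add: Z_def \<sigma>_def)
  also have "\<dots> = 2 * exp (- \<delta>)" by (simp add: exp_diff exp_minus field_simps)
  finally have Z: "Z \<le> 2 * exp (- \<delta>)" .
  have Z2: "Z \<le> 2" using Z \<delta> by (smt (verit) exp_le_one_iff)
  show ?thesis
  proof (cases "t \<ge> 4")
    case True
    have "exp (4::real) = exp 1 ^ 4" by (simp flip: exp_of_nat_mult)
    also have "\<dots> \<ge> 2 ^ 4" using exp_ge_add_one_self[of "1::real"] by (intro power_mono) auto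
    finally have "exp (- 4) \<le> (1/16::real)" by (simp add: exp_minus field_simps)
    moreover have "X \<le> exp (- 4)" using True by (simp add: X_def)
    ultimately have X: "X \<le> 1/16" by linarith
    have "Re q \<ge> 1/2" using True \<eta> by (simp add: Req)
    then have "norm g \<le> 3" unfolding g_def using \<eta> \<eta>_le by (intro norm_gain_le_3) auto
    then have Xg: "X * norm g \<le> 1/16 * 3" using X XZ0 by (intro mult_mono) auto
    have "norm (of_real X * g - of_real Z * cis (- b * t)) \<le> X * norm g + Z"
      using norm_triangle_ineq4[of "of_real X * g" "of_real Z * cis (- b * t)"] XZ0
      by (simp add: norm_mult)
    then have "norm (of_real X * g - of_real Z * cis (- b * t)) \<le> 3"
      using Xg Z2 by linarith
    then have "(X * norm g) * norm (of_real X * g - of_real Z * cis (- b * t)) \<le> 1/16 * 3 * 3"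
      using XZ0 by (intro mult_mono[OF Xg]) auto
    then show ?thesis by (simp add: normf normfz)
  next
    case False
    then have t4: "\<bar>t\<bar> \<le> 4" using \<open>t \<ge> - 2\<close> by linarith
    then have t2: "t\<^sup>2 \<le> 16" using abs_le_square_iff[of t 4] by simp
    have \<eta>t2: "\<eta> * t\<^sup>2 \<le> r"
    proof -
      have "\<eta> * t\<^sup>2 \<le> \<eta> * 16" using t2 \<eta> by simp
      also have "\<dots> = r * (16 * r)" by (simp add: \<eta>_eq)
      also have "\<dots> \<le> r * 1" using r by (intro mult_left_mono) auto
      finally show ?thesis by simp
    qed
    \<comment> \<open>Both \<open>t\<close> and \<open>\<sigma>\<close> being bounded on the relevant side, the viscous damping exponent is bounded.\<close>
    have "b\<^sup>2 / (4 * \<eta>) \<le> 9" using \<sigma>_eq \<sigma> \<eta>t2 r t4 by linarith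
    then have "b\<^sup>2 \<le> (6 * r)\<^sup>2" using \<eta> by (simp add: \<eta>_eq field_simps power2_eq_square)
    then have b: "\<bar>b\<bar> \<le> 6 * r" using r abs_le_square_iff[of b "6 * r"] by simp
    have "norm (q - 1) \<le> \<bar>2 * \<eta> * t\<bar> + \<bar>b\<bar>"
      using cmod_le[of "q - 1"] by (simp add: q_eq)
    also have "\<bar>2 * \<eta> * t\<bar> \<le> r"
    proof -
      have "\<bar>2 * \<eta> * t\<bar> = r * (2 * r * \<bar>t\<bar>)" using r by (simp add: \<eta>_eq abs_mult)
      also have "\<dots> \<le> r * (2 * r * 4)" using r t4 by (intro mult_left_mono) auto
      also have "\<dots> \<le> r * 1" using r by (intro mult_left_mono) auto
      finally show ?thesis by simp
    qed
    finally have "norm (q - 1) \<le> 10 * r" using b r by linarith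
    moreover from this have "norm (g - 1) \<le> 2 * norm (q - 1)"
      unfolding g_def using r \<eta> Req0 by (intro norm_gain_minus_1_le) auto
    ultimately have g1: "norm (g - 1) \<le> 20 * r" by linarith
    then have g: "norm g \<le> 1 + 20 * r"
      using norm_triangle_ineq[of "g - 1" 1] by simp
    have "\<bar>- b * t\<bar> \<le> 6 * r * 4" unfolding abs_mult using b t4 r by (intro mult_mono) auto
    then have c1: "norm (cis (- b * t) - 1) \<le> 24 * r"
      using norm_cis_minus_1_le[of "- b * t"] by linarith
    have "X \<le> exp 2" using \<open>t \<ge> - 2\<close> by (simp add: X_def)
    also have "exp (2::real) = exp 1 ^ 2" by (simp flip: exp_of_nat_mult)
    also have "\<dots> \<le> 3 ^ 2" using exp_le by (intro power_mono) auto
    finally have X9: "X \<le> 9" by simp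
    \<comment> \<open>The damping term \<open>b\<^sup>2 / (4\<eta>)\<close> only helps here; the error comes from \<open>\<eta>t\<^sup>2 \<le> r\<close>.\<close>
    have "X \<le> Z * (1 + 2 * r)"
    proof -
      have "b\<^sup>2 / (4 * \<eta>) \<ge> 0" using \<eta> by simp
      then have "X \<le> exp (- \<sigma> + r)" using \<sigma>_eq \<eta>t2 by (simp add: X_def)
      also have "\<dots> = Z * exp r" unfolding Z_def by (rule exp_add)
      also have "\<dots> \<le> Z * (1 + r + r\<^sup>2)" using XZ0 r by (intro mult_left_mono exp_bound) auto
      also have "\<dots> \<le> Z * (1 + 2 * r)"
        using XZ0 r by (intro mult_left_mono) (auto simp: power2_eq_square)
      finally show ?thesis .
    qed
    then have main: "X * \<bar>X - Z\<bar> \<le> Z\<^sup>2 / 4 + 9 * Z * (2 * r)"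
      using X9 XZ0 r by (intro mult_abs_diff_le) auto
    have "Z\<^sup>2 \<le> (2 * exp (- \<delta>))\<^sup>2" using Z XZ0 by (intro power_mono) auto
    also have "\<dots> = 4 * exp (- 2 * \<delta>)" by (simp add: power2_eq_square flip: exp_add)
    finally have "Z\<^sup>2 / 4 \<le> exp (- 2 * \<delta>)" by simp
    moreover have "9 * Z * (2 * r) \<le> 9 * 2 * (2 * r)" using Z2 XZ0 r by (intro mult_mono) auto
    ultimately have main': "X * \<bar>X - Z\<bar> \<le> exp (- 2 * \<delta>) + 36 * r" using main by simp
    define n where "n = norm (of_real X * g - of_real Z * cis (- b * t))"
    \<comment> \<open>Compare with the limiting case \<open>g = 1\<close>, \<open>bt = 0\<close>.\<close>
    have "of_real X * g - of_real Z * cis (- b * t) =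
        of_real (X - Z) + (of_real X * (g - 1) - of_real Z * (cis (- b * t) - 1))"
      by (simp add: algebra_simps)
    then have "n \<le> norm (of_real (X - Z) :: complex)
        + (norm (of_real X * (g - 1)) + norm (of_real Z * (cis (- b * t) - 1)))"
      unfolding n_def by (metis norm_triangle_ineq norm_triangle_ineq4 add_left_mono order_trans)
    also have "\<dots> = \<bar>X - Z\<bar> + (X * norm (g - 1) + Z * norm (cis (- b * t) - 1))"
      unfolding norm_mult norm_of_real using XZ0 by simp
    finally have "n \<le> \<bar>X - Z\<bar> + (X * norm (g - 1) + Z * norm (cis (- b * t) - 1))" .
    moreover have "X * norm (g - 1) \<le> 9 * (20 * r)" using X9 g1 XZ0 by (intro mult_mono) auto
    moreover have "Z * norm (cis (- b * t) - 1) \<le> 2 * (24 * r)"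
      using Z2 c1 XZ0 by (intro mult_mono) auto
    ultimately have n: "n \<le> \<bar>X - Z\<bar> + 228 * r" by linarith
    have Xg: "X * norm g \<le> X * (1 + 20 * r)" using g XZ0 by simp
    have "X * norm g * n \<le> X * (1 + 20 * r) * (\<bar>X - Z\<bar> + 228 * r)"
      using Xg n XZ0 r by (intro mult_mono) (auto simp: n_def)
    also have "\<dots> = X * \<bar>X - Z\<bar> + 20 * r * (X * \<bar>X - Z\<bar>) + X * ((1 + 20 * r) * (228 * r))"
      by (simp add: algebra_simps)
    also have "\<dots> \<le> (exp (- 2 * \<delta>) + 36 * r) + 20 * r * (9 * 11) + 9 * (2 * (228 * r))"
    proof (intro add_mono mult_mono)
      show "X * \<bar>X - Z\<bar> \<le> exp (- 2 * \<delta>) + 36 * r" by (rule main')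
    qed (use X9 XZ0 Z2 r in auto)
    also have "\<dots> \<le> exp (- 2 * \<delta>) + 7000 * r" using r by simp
    also have "\<dots> < 1" using small by (simp add: r_def)
    finally show ?thesis by (simp add: normf normfz n_def)
  qed
qed

theorem theorem1:
  fixes \<delta> :: real
  assumes "\<delta> > 0"
  shows "\<exists>\<eta>\<^sub>1 > 0. \<forall>\<eta> \<in> {0<..<\<eta>\<^sub>1}. spectral_abscissa \<eta> \<le> ereal (- ln 2 + \<delta>)"
proof -
  define c where "c = (1 - exp (- 2 * \<delta>)) / 7000"
  have c: "0 < c" "c < 1/2" using assms exp_gt_zero[of "- 2 * \<delta>"]
    by (auto simp: c_def simp del: exp_gt_zero)
  show ?thesis
  proof (intro exI[of _ "c\<^sup>2"] conjI ballI)
    show "c\<^sup>2 > 0" using c by simp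
    fix \<eta> assume "\<eta> \<in> {0<..<c\<^sup>2}"
    then have \<eta>: "0 < \<eta>" "\<eta> < c\<^sup>2" by auto
    then have small: "sqrt \<eta> < c" using c by (auto intro: real_less_lsqrt)
    have "c\<^sup>2 < (1/2)\<^sup>2" using c by (intro power_strict_mono) auto
    then have "\<eta> < 1/4" using \<eta> by (simp add: power2_eq_square)
    show "spectral_abscissa \<eta> \<le> ereal (- ln 2 + \<delta>)"
      unfolding spectral_abscissa_def
    proof (rule SUP_least)
      fix s assume "s \<in> spectrum_eta \<eta>"
      then consider (root) "(transfer \<eta> s)\<^sup>2 - transfer \<eta> s * exp (- s) - 1 = 0"
        | (exceptional) "s = - 1 / (4 * of_real \<eta>)"
        by (auto simp: spectrum_eta_def)
      then have "Re s \<le> - ln 2 + \<delta>"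
      proof cases
        case root
        then have "transfer \<eta> s * (transfer \<eta> s - exp (- s)) = 1"
          by (simp add: power2_eq_square algebra_simps)
        then have "norm (transfer \<eta> s) * norm (transfer \<eta> s - exp (- s)) = 1"
          by (metis norm_mult norm_one)
        then show ?thesis
          using norm_transfer_product_less_1[of \<eta> \<delta> s] \<eta> small assms
          by (force simp: c_def)
      next
        case exceptional
        then have "s = of_real (- 1 / (4 * \<eta>))" by simp
        then have "Re s = - 1 / (4 * \<eta>)" by (simp only: Re_complex_of_real)
        moreover have "1 / (4 * \<eta>) > 1" using \<eta> \<open>\<eta> < 1/4\<close> by simp
        ultimately show ?thesis using assms ln_2_less_1 by simp
      qed
      then show "ereal (Re s) \<le> ereal (- ln 2 + \<delta>)" by simp
    qed
  qed
qed

end
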